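(* Let $\boldsymbol{P}=\boldsymbol{P}_{\rm s}+\boldsymbol{P}_{\rm i}\epsilon$ be an $n\times n$ dual transitional probability matrix (DTPM). Then, with respect to the total order on dual numbers and among all $n\times n$ DTPMs, the dual-valued effective information ${\rm EI_d}(\boldsymbol{P})$ (i) reaches its maximum value of $\log_2 n$ if and only if $\boldsymbol{P}$ is a permutation matrix; (ii) reaches its minimum value of $0$ if and only if $\boldsymbol{P}=\boldsymbol{u}\mathbf{1}^\top+\boldsymbol{P}_{\rm i}\epsilon$ for some $\boldsymbol{u}\in\mathbb{R}^n$ with $\mathbf{1}^\top\boldsymbol{u}=1$.
   Context: Dual numbers: $\mathbb{DR}=\{p_{\rm s}+p_{\rm i}\epsilon: p_{\rm s},p_{\rm i}\in\mathbb{R}\}$ with $\epsilon\neq0$, $\epsilon^2=0$ (a commutative ring), with total order $p<q$ if $p_{\rm s}<q_{\rm s}$, or $p_{\rm s}=q_{\rm s}$ and $p_{\rm i}<q_{\rm i}$. Dual matrices are written $\boldsymbol{P}=\boldsymbol{P}_{\rm s}+\boldsymbol{P}_{\rm i}\epsilon$ with real $\boldsymbol{P}_{\rm s},\boldsymbol{P}_{\rm i}$. $\mathbf{1}$ is the all-ones vector in $\mathbb{R}^n$. An $n\times n$ DTPM is a dual matrix $\boldsymbol{P}\in\mathbb{DR}^{n\times n}$ all of whose entries are $\ge0$ in the total order and with $\mathbf{1}^\top\boldsymbol{P}=\mathbf{1}^\top$ (so $\boldsymbol{P}_{\rm s}\ge\boldsymbol{O}$, $\mathbf{1}^\top\boldsymbol{P}_{\rm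 s}=\mathbf{1}^\top$, $\mathbf{1}^\top\boldsymbol{P}_{\rm i}=\boldsymbol{0}^\top$, and $[\boldsymbol{P}_{\rm i}]_{jk}\ge0$ whenever $[\boldsymbol{P}_{\rm s}]_{jk}=0$). A DTPM is called a permutation matrix if $\boldsymbol{P}_{\rm s}$ is a permutation matrix and $\boldsymbol{P}_{\rm i}=\boldsymbol{O}$. The dual-valued effective information of a DTPM is $${\rm EI_d}(\boldsymbol{P})=\frac1n\Big\langle\boldsymbol{P},\ \log_2\boldsymbol{P}-\log_2\big(\tfrac1n\boldsymbol{P}\mathbf{1}\mathbf{1}^\top\big)\Big\rangle\in\mathbb{DR},$$ where $\langle\boldsymbol{X},\boldsymbol{Y}\rangle=\sum_{j,k}X_{jk}Y_{jk}$ and $\log_2$ acts entrywise on nonnegative dual numbers by $\log_2(a+b\epsilon)=\log_2a+\frac{b}{a\ln2}\epsilon$ if $a>0$; $\log_2(a+b\epsilon)=(\log_2 b)\,\epsilon$ if $a=0$, $b>0$; and $\log_2(0)=0$. *)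

theory Defs
  imports "HOL-Analysis.Analysis" "HOL-Combinatorics.Permutations"
begin

section \<open>Dual numbers\<close>

datatype dual_number = Dual (st: real) (im: real)

instantiation dual_number :: comm_ring_1
begin

definition "0 = Dual 0 0"
definition "1 = Dual 1 0"
definition "p + q = Dual (st p + st q) (im p + im q)"
definition "p - q = Dual (st p - st q) (im p - im q)"
definition "- p = Dual (- st p) (- im p)"
definition "p * q = Dual (st p * st q) (st p * im q + im p * st q)"

instance
  by standard
    (simp_all add: zero_dual_number_def one_dual_number_def plus_dual_number_def
      minus_dual_number_def uminus_dual_number_def times_dual_number_def algebra_simps
      dual_number.expand)

end

instantiation dual_number :: real_algebra_1
begin

definition "c *\<^sub>R p = Dual (c * st p) (c * im p)"

instance
  by standard
    (simp_all add: scaleR_dual_number_def plus_dual_number_def times_dual_number_def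
      algebra_simps)

end

instantiation dual_number :: linorder
begin

definition "p < q \<longleftrightarrow> st p < st q \<or> st p = st q \<and> im p < im q"
definition "p \<le> q \<longleftrightarrow> p < q \<or> p = q" for p q :: dual_number

instance
  by standard
    (auto simp: less_dual_number_def less_eq_dual_number_def intro: dual_number.expand)

end

definition eps :: dual_number where
  "eps = Dual 0 1"

lemma eps_nonzero: "eps \<noteq> 0"
  by (simp add: eps_def zero_dual_number_def)

lemma eps_squared: "eps * eps = 0"
  by (simp add: eps_def times_dual_number_def zero_dual_number_def)

lemma Dual_eq: "Dual a b = of_real a + of_real b * eps"
  by (simp add: eps_def of_real_def scaleR_dual_number_def one_dual_number_def
      plus_dual_number_def times_dual_number_def)

text \<open>Only nonnegative dual numbers matter here; elsewhere the value is the junk value \<open>0\<close>.\<close>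

definition dual_log2 :: "dual_number \<Rightarrow> dual_number" where
  "dual_log2 p =
    (if st p > 0 then of_real (log 2 (st p)) + of_real (im p / (st p * ln 2)) * eps
     else if st p = 0 \<and> im p > 0 then of_real (log 2 (im p)) * eps
     else 0)"


section \<open>Dual matrices\<close>

definition dual_matrix :: "real^'n^'m \<Rightarrow> real^'n^'m \<Rightarrow> dual_number^'n^'m" where
  "dual_matrix A B = (\<chi> j k. of_real (A $ j $ k) + of_real (B $ j $ k) * eps)"

definition outer_product :: "('a::times)^'m \<Rightarrow> 'a^'n \<Rightarrow> 'a^'n^'m" where
  "outer_product u v = (\<chi> j k. u $ j * v $ k)"

definition matrix_inner :: "('a::comm_semiring_0)^'n^'m \<Rightarrow> 'a^'n^'m \<Rightarrow> 'a" where
  "matrix_inner X Y = (\<Sum>j\<in>UNIV. \<Sum>k\<in>UNIV. X $ j $ k * Y $ j $ k)"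

definition log2_matrix :: "dual_number^'n^'m \<Rightarrow> dual_number^'n^'m" where
  "log2_matrix P = (\<chi> j k. dual_log2 (P $ j $ k))"

text \<open>The vector \<open>1\<close> of type \<open>'a^'n\<close> is the all-ones vector, so \<open>1 v* P = 1\<close> says that
  every column of \<open>P\<close> sums to one.\<close>

definition DTPM :: "dual_number^'n^'n \<Rightarrow> bool" where
  "DTPM P \<longleftrightarrow> (\<forall>j k. 0 \<le> P $ j $ k) \<and> 1 v* P = 1"

definition real_permutation_matrix :: "real^'n^'n \<Rightarrow> bool" where
  "real_permutation_matrix A \<longleftrightarrow>
    (\<exists>\<sigma>. \<sigma> permutes UNIV \<and> A = (\<chi> j k. if j = \<sigma> k then 1 else 0))"

definition permutation_DTPM :: "dual_number^'n^'n \<Rightarrow> bool" where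
  "permutation_DTPM P \<longleftrightarrow>
    real_permutation_matrix (\<chi> j k. st (P $ j $ k)) \<and> (\<forall>j k. im (P $ j $ k) = 0)"

definition EI_d :: "dual_number^'n^'n \<Rightarrow> dual_number" where
  "EI_d P = (1 / real CARD('n)) *\<^sub>R
     matrix_inner P
       (log2_matrix P - log2_matrix ((1 / real CARD('n)) *\<^sub>R outer_product (P *v 1) 1))"

lemma sum_Dual: "(\<Sum>j\<in>S. Dual (f j) (g j)) = Dual (sum f S) (sum g S)"
  by (induction S rule: infinite_finite_induct)
    (simp_all add: zero_dual_number_def plus_dual_number_def)

lemma DTPM_dual_matrix_iff:
  "DTPM (dual_matrix A B) \<longleftrightarrow>
    (\<forall>j k. 0 \<le> A $ j $ k) \<and> 1 v* A = 1 \<and> 1 v* B = 0 \<and>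
    (\<forall>j k. A $ j $ k = 0 \<longrightarrow> 0 \<le> B $ j $ k)"
proof -
  have nonneg: "0 \<le> Dual a b \<longleftrightarrow> 0 \<le> a \<and> (a = 0 \<longrightarrow> 0 \<le> b)" for a b
    by (auto simp: less_eq_dual_number_def less_dual_number_def zero_dual_number_def)
  have "1 v* dual_matrix A B = 1 \<longleftrightarrow> 1 v* A = 1 \<and> 1 v* B = 0"
    by (simp add: dual_matrix_def Dual_eq[symmetric] vector_matrix_mult_def vec_eq_iff
        sum_Dual)
      (auto simp: one_dual_number_def)
  then show ?thesis
    by (auto simp: DTPM_def dual_matrix_def Dual_eq[symmetric] nonneg)
qed

end

theory Submission
  imports Defs
begin

text \<open>
  Let \<open>n\<close> be the dimension.  Write \<open>a j k\<close> and \<open>b j k\<close> for the standard and the infinitesimal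
  part of the entries, and \<open>r j\<close>, \<open>s j\<close> for the two parts of the mean of row \<open>j\<close>.  The
  standard part of the effective information is the classical quantity
  \<open>(\<Sum>j. \<Sum>k. a j k * (log 2 (a j k) - log 2 (r j))) / n\<close>, a mutual information.  As the
  order is lexicographic, the infinitesimal part matters only where this standard part is
  already extremal, and there the matrix is so rigid that the infinitesimal part has a simple
  closed form.

  Maximum: \<open>a j k \<le> n * r j\<close> bounds each logarithm by \<open>log 2 n\<close>.  Equality forces every row to
  have at most one nonzero entry; since each of the \<open>n\<close> columns needs one, the standard part is
  a permutation matrix (lemma \<open>permutation_if_st_max\<close>).  If it is that of \<open>\<sigma>\<close>, the
  infinitesimal part equals \<open>(\<Sum>k. b (\<sigma> k) k) / (n * ln 2)\<close> (lemma \<open>im_EI_permutation\<close>).  All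
  other entries of \<open>b\<close> sit on zeros of \<open>a\<close> and hence are nonnegative; the columns of \<open>b\<close> sum to
  zero, so this number is nonpositive and vanishes only for \<open>b = 0\<close>.

  Minimum: Gibbs' inequality (lemma \<open>gibbs_term\<close>) shows that the standard part is nonnegative and
  vanishes exactly when \<open>a j k = r j\<close> throughout.  In that case the entries of \<open>b\<close> enter the
  infinitesimal part only through their deviations from the row means, which cancel
  (lemma \<open>im_EI_constant_rows\<close>).
\<close>


section \<open>Components of dual numbers\<close>

lemma st_im_arith [simp]:
  "st 0 = 0" "im 0 = 0" "st 1 = 1" "im 1 = 0"
  "st (p + q) = st p + st q" "im (p + q) = im p + im q"
  "st (p - q) = st p - st q" "im (p - q) = im p - im q"
  "st (p * q) = st p * st q" "im (p * q) = st p * im q + im p * st q"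
  "st (c *\<^sub>R p) = c * st p" "im (c *\<^sub>R p) = c * im p"
  "st (of_real c) = c" "im (of_real c) = 0" "st eps = 0" "im eps = 1"
  by (simp_all add: zero_dual_number_def one_dual_number_def plus_dual_number_def
      minus_dual_number_def times_dual_number_def scaleR_dual_number_def of_real_def eps_def)

lemma st_im_sum [simp]:
  "st (\<Sum>j\<in>S. f j) = (\<Sum>j\<in>S. st (f j))" "im (\<Sum>j\<in>S. f j) = (\<Sum>j\<in>S. im (f j))"
  by (induction S rule: infinite_finite_induct) auto

lemma dual_eq_iff: "p = q \<longleftrightarrow> st p = st q \<and> im p = im q"
  by (auto intro: dual_number.expand)

lemma dual_le_iff: "p \<le> q \<longleftrightarrow> st p < st q \<or> st p = st q \<and> im p \<le> im q"
  by (auto simp: less_eq_dual_number_def less_dual_number_def dual_eq_iff)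

text \<open>The case of a vanishing standard part rests on the convention \<open>log 2 0 = 0\<close>.\<close>

lemma st_dual_log2: "0 \<le> st p \<Longrightarrow> st (dual_log2 p) = log 2 (st p)"
  by (auto simp: dual_log2_def log_def)

lemma im_dual_log2_pos: "0 < st p \<Longrightarrow> im (dual_log2 p) = im p / (st p * ln 2)"
  by (simp add: dual_log2_def)

lemma dual_matrix_components:
  "st (dual_matrix A B $ j $ k) = A $ j $ k" "im (dual_matrix A B $ j $ k) = B $ j $ k"
  by (simp_all add: dual_matrix_def)


section \<open>Two real inequalities\<close>

text \<open>
  One summand of Gibbs' inequality: \<open>ln x \<le> x - 1\<close> at \<open>x = r / a\<close>, strict unless \<open>x = 1\<close>.
  The bound \<open>(a - r) / ln 2\<close> adds up to zero when \<open>a\<close> runs over all entries and \<open>r\<close> over the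
  corresponding row means.
\<close>

lemma gibbs_term:
  fixes a r :: real
  assumes "0 \<le> a" "0 \<le> r" "r = 0 \<Longrightarrow> a = 0"
  shows "(a - r) / ln 2 \<le> a * (log 2 a - log 2 r)"
    and "a * (log 2 a - log 2 r) = (a - r) / ln 2 \<Longrightarrow> a = r"
proof -
  have *: "(a - r) / ln 2 \<le> a * (log 2 a - log 2 r) \<and>
    (a * (log 2 a - log 2 r) = (a - r) / ln 2 \<longrightarrow> a = r)"
  proof (cases "a = 0")
    case True
    then show ?thesis using assms by auto
  next
    case False
    with assms have pos: "0 < a" "0 < r" by fastforce+
    have eq: "a * (log 2 a - log 2 r) = - (a * ln (r / a)) / ln 2"
      using pos by (simp add: log_def ln_div field_simps)
    have le: "a * ln (r / a) \<le> a * (r / a - 1)"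
      using pos ln_le_minus_one[of "r / a"] by (intro mult_left_mono) auto
    have "a * (r / a - 1) = r - a" using pos by (simp add: field_simps)
    with le have le': "a * ln (r / a) \<le> r - a" by simp
    moreover have "a = r" if "a * ln (r / a) = r - a"
    proof -
      have "ln (r / a) = r / a - 1" using that pos by (simp add: field_simps)
      then have "r / a = 1" using pos by (intro ln_eq_minus_one) auto
      then show ?thesis using pos by simp
    qed
    moreover have "- (a * ln (r / a)) / ln 2 - (a - r) / ln 2 = (r - a - a * ln (r / a)) / ln 2"
      by (simp add: field_simps)
    ultimately show ?thesis
      unfolding eq by (smt (verit) divide_eq_0_iff divide_nonneg_pos ln_gt_zero)
  qed
  from * show "(a - r) / ln 2 \<le> a * (log 2 a - log 2 r)" by blast
  from * show "a * (log 2 a - log 2 r) = (a - r) / ln 2 \<Longrightarrow> a = r" by blast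
qed

lemma log_ratio_term:
  fixes a r m :: real
  assumes "0 \<le> a" "a \<le> m * r" "0 < m" "0 \<le> r"
  shows "a * (log 2 a - log 2 r) \<le> a * log 2 m"
    and "a * (log 2 a - log 2 r) = a * log 2 m \<Longrightarrow> a = 0 \<or> a = m * r"
proof -
  have *: "a * (log 2 a - log 2 r) \<le> a * log 2 m \<and>
    (a * (log 2 a - log 2 r) = a * log 2 m \<longrightarrow> a = m * r)" if "a \<noteq> 0"
  proof -
    have pos: "0 < a" "0 < r" using that assms by (auto simp: less_le)
    have "log 2 (m * r) = log 2 m + log 2 r" using pos assms by (simp add: log_mult)
    moreover have "log 2 a \<le> log 2 (m * r)" using pos assms by simp
    moreover have "log 2 a = log 2 (m * r) \<Longrightarrow> a = m * r"
      using pos assms by (simp add: log_def)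
    ultimately show ?thesis using pos by auto
  qed
  from * show "a * (log 2 a - log 2 r) \<le> a * log 2 m" by (cases "a = 0") auto
  from * show "a * (log 2 a - log 2 r) = a * log 2 m \<Longrightarrow> a = 0 \<or> a = m * r" by blast
qed

lemma double_sum_le_equality:
  fixes f g :: "'a::finite \<Rightarrow> 'b::finite \<Rightarrow> real"
  assumes "\<And>j k. f j k \<le> g j k"
    and "(\<Sum>j\<in>UNIV. \<Sum>k\<in>UNIV. f j k) = (\<Sum>j\<in>UNIV. \<Sum>k\<in>UNIV. g j k)"
  shows "f j k = g j k"
proof -
  have "(\<Sum>j\<in>UNIV. \<Sum>k\<in>UNIV. g j k - f j k) = 0"
    using assms(2) by (simp add: sum_subtractf)
  moreover have "\<And>j. 0 \<le> (\<Sum>k\<in>UNIV. g j k - f j k)"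
    using assms(1) by (intro sum_nonneg) simp
  ultimately have "(\<Sum>k\<in>UNIV. g j k - f j k) = 0"
    by (simp add: sum_nonneg_eq_0_iff)
  then have "g j k - f j k = 0"
    using assms(1) by (subst (asm) sum_nonneg_eq_0_iff) auto
  then show ?thesis by simp
qed


section \<open>Effective information in components\<close>

locale dual_transition_matrix =
  fixes Q :: "dual_number^'n^'n"
  assumes DTPM_Q: "DTPM Q"
begin

abbreviation a :: "'n \<Rightarrow> 'n \<Rightarrow> real" where "a j k \<equiv> st (Q $ j $ k)"

abbreviation b :: "'n \<Rightarrow> 'n \<Rightarrow> real" where "b j k \<equiv> im (Q $ j $ k)"

definition r :: "'n \<Rightarrow> real" where "r j = (\<Sum>k\<in>UNIV. a j k) / real CARD('n)"

definition s :: "'n \<Rightarrow> real" where "s j = (\<Sum>k\<in>UNIV. b j k) / real CARD('n)"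

lemma entry_nonneg: "0 < a j k \<or> 0 = a j k \<and> 0 \<le> b j k"
proof -
  have "0 \<le> Q $ j $ k" using DTPM_Q by (simp add: DTPM_def)
  then show ?thesis by (simp add: dual_le_iff)
qed

lemma a_nonneg: "0 \<le> a j k"
  using entry_nonneg[of j k] by auto

lemma b_nonneg: "a j k = 0 \<Longrightarrow> 0 \<le> b j k"
  using entry_nonneg[of j k] by auto

lemma column_sums: "(\<Sum>j\<in>UNIV. a j k) = 1" "(\<Sum>j\<in>UNIV. b j k) = 0"
proof -
  have "(1 v* Q) $ k = 1" using DTPM_Q by (simp add: DTPM_def)
  then have "(\<Sum>j\<in>UNIV. Q $ j $ k) = 1" by (simp add: vector_matrix_mult_def)
  then show "(\<Sum>j\<in>UNIV. a j k) = 1" "(\<Sum>j\<in>UNIV. b j k) = 0"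
    by (simp_all add: dual_eq_iff)
qed

lemma total_sums:
  "(\<Sum>j\<in>UNIV. \<Sum>k\<in>UNIV. a j k) = real CARD('n)" "(\<Sum>j\<in>UNIV. \<Sum>k\<in>UNIV. b j k) = 0"
  by (subst sum.swap, simp add: column_sums)+

lemma row_sums:
  "(\<Sum>k\<in>UNIV. a j k) = real CARD('n) * r j" "(\<Sum>k\<in>UNIV. b j k) = real CARD('n) * s j"
  by (simp_all add: r_def s_def)

lemma r_nonneg: "0 \<le> r j"
  by (simp add: r_def sum_nonneg a_nonneg)

lemma a_le_row_sum: "a j k \<le> real CARD('n) * r j"
  unfolding row_sums[symmetric] by (intro member_le_sum) (auto simp: a_nonneg)

lemma a_zero_if_r_zero: "r j = 0 \<Longrightarrow> a j k = 0"
  using a_le_row_sum[of j k] a_nonneg[of j k] by simp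

lemma sum_mean: "(\<Sum>j\<in>UNIV. r j) = 1" "(\<Sum>j\<in>UNIV. s j) = 0"
  by (simp_all add: r_def s_def total_sums flip: sum_divide_distrib)

lemma row_mean_components:
  "st (((1 / real CARD('n)) *\<^sub>R outer_product (Q *v 1) 1) $ j $ k) = r j"
  "im (((1 / real CARD('n)) *\<^sub>R outer_product (Q *v 1) 1) $ j $ k) = s j"
  by (simp_all add: outer_product_def matrix_vector_mult_def r_def s_def)

lemma row_mean_Dual:
  "((1 / real CARD('n)) *\<^sub>R outer_product (Q *v 1) 1) $ j $ k = Dual (r j) (s j)"
  by (simp add: dual_eq_iff row_mean_components del: vector_scaleR_component)

lemma EI_d_eq: "EI_d Q = (1 / real CARD('n)) *\<^sub>R
    (\<Sum>j\<in>UNIV. \<Sum>k\<in>UNIV. Q $ j $ k * (dual_log2 (Q $ j $ k) - dual_log2 (Dual (r j) (s j))))"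
  by (simp add: EI_d_def matrix_inner_def log2_matrix_def row_mean_Dual
      del: vector_scaleR_component)

lemma st_EI_d: "st (EI_d Q) =
    (\<Sum>j\<in>UNIV. \<Sum>k\<in>UNIV. a j k * (log 2 (a j k) - log 2 (r j))) / real CARD('n)"
  by (simp add: EI_d_eq st_dual_log2 a_nonneg r_nonneg)

lemma im_EI_d: "im (EI_d Q) =
    (\<Sum>j\<in>UNIV. \<Sum>k\<in>UNIV.
       a j k * (im (dual_log2 (Q $ j $ k)) - im (dual_log2 (Dual (r j) (s j)))) +
       b j k * (log 2 (a j k) - log 2 (r j))) / real CARD('n)"
  by (simp add: EI_d_eq st_dual_log2 a_nonneg r_nonneg)


section \<open>The maximum\<close>

lemma st_EI_d_le: "st (EI_d Q) \<le> log 2 (real CARD('n))"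
proof -
  have "(\<Sum>j\<in>UNIV. \<Sum>k\<in>UNIV. a j k * (log 2 (a j k) - log 2 (r j)))
      \<le> (\<Sum>j\<in>UNIV. \<Sum>k\<in>UNIV. a j k * log 2 (real CARD('n)))"
    by (intro sum_mono log_ratio_term(1) a_nonneg a_le_row_sum r_nonneg) simp
  also have "\<dots> = real CARD('n) * log 2 (real CARD('n))"
    by (simp add: total_sums flip: sum_distrib_right)
  finally show ?thesis by (simp add: st_EI_d field_simps)
qed

text \<open>
  Equality in every summand leaves at most one nonzero entry per row.  Picking a nonzero entry in
  each column is then an injective, hence bijective, choice of rows, so that the remaining
  entries vanish.
\<close>

lemma permutation_if_st_max:
  assumes "st (EI_d Q) = log 2 (real CARD('n))"
  obtains \<sigma> where "\<sigma> permutes UNIV" "\<And>j k. a j k = (if j = \<sigma> k then 1 else 0)"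
proof -
  have "(\<Sum>j\<in>UNIV. \<Sum>k\<in>UNIV. a j k * (log 2 (a j k) - log 2 (r j))) =
      real CARD('n) * log 2 (real CARD('n))"
    using assms by (simp add: st_EI_d field_simps)
  also have "\<dots> = (\<Sum>j\<in>UNIV. \<Sum>k\<in>UNIV. a j k * log 2 (real CARD('n)))"
    by (simp add: total_sums flip: sum_distrib_right)
  finally have sums_eq: "(\<Sum>j\<in>UNIV. \<Sum>k\<in>UNIV. a j k * (log 2 (a j k) - log 2 (r j))) =
      (\<Sum>j\<in>UNIV. \<Sum>k\<in>UNIV. a j k * log 2 (real CARD('n)))" .
  have terms_eq: "a j k * (log 2 (a j k) - log 2 (r j)) = a j k * log 2 (real CARD('n))" for j k
    by (rule double_sum_le_equality[OF _ sums_eq])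
      (intro log_ratio_term(1) a_nonneg a_le_row_sum r_nonneg, simp)
  have zero_or_row_sum: "a j k = 0 \<or> a j k = real CARD('n) * r j" for j k
    by (rule log_ratio_term(2)[OF a_nonneg a_le_row_sum _ r_nonneg terms_eq]) simp
  have row_unique: "k = k'" if "a j k \<noteq> 0" "a j k' \<noteq> 0" for j k k'
  proof (rule ccontr)
    assume "k \<noteq> k'"
    then have "a j k + a j k' = (\<Sum>i\<in>{k, k'}. a j i)" by simp
    also have "\<dots> \<le> real CARD('n) * r j"
      unfolding row_sums(1)[symmetric] by (intro sum_mono2) (auto simp: a_nonneg)
    finally show False
      using zero_or_row_sum[of j k] zero_or_row_sum[of j k'] that a_nonneg[of j k] by auto
  qed
  have "\<exists>j. a j k \<noteq> 0" for k
  proof (rule ccontr)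
    assume "\<not> ?thesis"
    then show False using column_sums(1)[of k] by simp
  qed
  then obtain \<sigma> where \<sigma>: "\<And>k. a (\<sigma> k) k \<noteq> 0" by metis
  have "inj \<sigma>" using \<sigma> row_unique by (intro injI) metis
  then have surj: "surj \<sigma>" by (simp add: finite_UNIV_inj_surj)
  have zero: "a j k = 0" if "j \<noteq> \<sigma> k" for j k
  proof (rule ccontr)
    assume nz: "a j k \<noteq> 0"
    obtain k' where "j = \<sigma> k'" using surj by blast
    with nz \<sigma>[of k'] row_unique[of j k k'] that show False by simp
  qed
  have one: "a (\<sigma> k) k = 1" for k
  proof -
    have "(\<Sum>j\<in>UNIV. a j k) = (\<Sum>j\<in>{\<sigma> k}. a j k)"
      by (rule sum.mono_neutral_right) (auto simp: zero)
    then show ?thesis by (simp add: column_sums)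
  qed
  show thesis
  proof (rule that)
    show "\<sigma> permutes UNIV"
      using \<open>inj \<sigma>\<close> surj by (intro bij_imp_permutes) (simp_all add: bij_def)
    show "a j k = (if j = \<sigma> k then 1 else 0)" for j k
      using zero one by auto
  qed
qed

lemma row_mean_permutation:
  assumes "\<sigma> permutes UNIV" "\<And>j k. a j k = (if j = \<sigma> k then 1 else 0)"
  shows "r j = 1 / real CARD('n)"
proof -
  have "j = \<sigma> k \<longleftrightarrow> k = inv \<sigma> j" for k
    using assms(1) by (metis permutes_inverses(1,2))
  then have "(\<Sum>k\<in>UNIV. a j k) = (\<Sum>k\<in>UNIV. if k = inv \<sigma> j then 1 else 0)"
    by (simp add: assms(2))
  then show ?thesis by (simp add: r_def)
qed

lemma st_EI_permutation:
  assumes "\<sigma> permutes UNIV" "\<And>j k. a j k = (if j = \<sigma> k then 1 else 0)"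
  shows "st (EI_d Q) = log 2 (real CARD('n))"
proof -
  have "a j k * (log 2 (a j k) - log 2 (r j)) = a j k * log 2 (real CARD('n))" for j k
    by (simp add: row_mean_permutation[OF assms] assms(2) log_divide)
  then show ?thesis
    by (simp only: st_EI_d) (simp add: total_sums flip: sum_distrib_right)
qed

text \<open>
  Here all logarithms \<open>log 2 (a j k)\<close> are \<open>0\<close>, at the zero entries by the convention
  \<open>log 2 0 = 0\<close>, and with \<open>n\<close> the dimension all row means \<open>r j\<close> are \<open>1 / n\<close>.  So the
  logarithmic terms add up to a multiple of the total sum of \<open>b\<close>, which is zero.  Only the
  derivative of the logarithm at the \<open>n\<close> nonzero entries contributes.
\<close>

lemma im_EI_permutation:
  assumes "\<sigma> permutes UNIV" "\<And>j k. a j k = (if j = \<sigma> k then 1 else 0)"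
  shows "im (EI_d Q) = (\<Sum>k\<in>UNIV. b (\<sigma> k) k) / (real CARD('n) * ln 2)"
proof -
  note r = row_mean_permutation[OF assms]
  have log_a: "log 2 (a j k) = 0" for j k
    by (simp add: assms(2) log_def)
  let ?d = "\<lambda>j k. if j = \<sigma> k then (b j k - real CARD('n) * s j) / ln 2 else 0"
  have summand: "a j k * (im (dual_log2 (Q $ j $ k)) - im (dual_log2 (Dual (r j) (s j)))) +
      b j k * (log 2 (a j k) - log 2 (r j)) = ?d j k + b j k * log 2 (real CARD('n))" for j k
    by (simp only: log_a) (simp add: assms(2) r im_dual_log2_pos log_divide diff_divide_distrib)
  have "(\<Sum>j\<in>UNIV. \<Sum>k\<in>UNIV. ?d j k) = (\<Sum>k\<in>UNIV. \<Sum>j\<in>UNIV. ?d j k)"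
    by (rule sum.swap)
  also have "\<dots> = (\<Sum>k\<in>UNIV. (b (\<sigma> k) k - real CARD('n) * s (\<sigma> k)) / ln 2)"
    by simp
  also have "\<dots> = ((\<Sum>k\<in>UNIV. b (\<sigma> k) k) - real CARD('n) * (\<Sum>k\<in>UNIV. s (\<sigma> k))) / ln 2"
    by (simp add: sum_subtractf sum_distrib_left flip: sum_divide_distrib)
  also have "(\<Sum>k\<in>UNIV. s (\<sigma> k)) = 0"
    using sum.permute[OF assms(1), of s] by (simp add: sum_mean comp_def)
  finally have "(\<Sum>j\<in>UNIV. \<Sum>k\<in>UNIV. ?d j k) = (\<Sum>k\<in>UNIV. b (\<sigma> k) k) / ln 2"
    by simp
  moreover have "(\<Sum>j\<in>UNIV. \<Sum>k\<in>UNIV. b j k * log 2 (real CARD('n))) = 0"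
    by (simp add: total_sums flip: sum_distrib_right)
  ultimately show ?thesis
    by (simp only: im_EI_d summand sum.distrib) (simp add: mult.commute)
qed

text \<open>
  A column of \<open>b\<close> sums to zero and is nonnegative off the nonzero entry of \<open>a\<close>.
\<close>

lemma b_at_permutation:
  assumes "\<And>j k. a j k = (if j = \<sigma> k then 1 else 0)"
  shows "b (\<sigma> k) k \<le> 0" and "b (\<sigma> k) k = 0 \<Longrightarrow> b j k = 0"
proof -
  have split: "b (\<sigma> k) k + (\<Sum>j\<in>UNIV - {\<sigma> k}. b j k) = 0"
    using column_sums(2)[of k] by (simp add: sum.remove[of UNIV "\<sigma> k"])
  have nonneg: "0 \<le> b j k" if "j \<in> UNIV - {\<sigma> k}" for j
    using that by (intro b_nonneg) (simp add: assms)
  show "b (\<sigma> k) k \<le> 0"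
    using split sum_nonneg[of "UNIV - {\<sigma> k}" "\<lambda>j. b j k"] nonneg by simp
  show "b j k = 0" if "b (\<sigma> k) k = 0"
  proof -
    have "\<forall>j\<in>UNIV - {\<sigma> k}. b j k = 0"
      using split that nonneg by (subst sum_nonneg_eq_0_iff[symmetric]) auto
    with that show ?thesis by (cases "j = \<sigma> k") auto
  qed
qed

lemma EI_d_le_log: "EI_d Q \<le> of_real (log 2 (real CARD('n)))"
proof (cases "st (EI_d Q) = log 2 (real CARD('n))")
  case True
  then obtain \<sigma> where \<sigma>: "\<sigma> permutes UNIV" "\<And>j k. a j k = (if j = \<sigma> k then 1 else 0)"
    by (rule permutation_if_st_max) blast
  have "(\<Sum>k\<in>UNIV. b (\<sigma> k) k) \<le> 0"
    by (intro sum_nonpos b_at_permutation(1) \<sigma>(2))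
  then have "im (EI_d Q) \<le> 0"
    by (simp add: im_EI_permutation[OF \<sigma>] divide_nonpos_pos)
  with True show ?thesis by (simp add: dual_le_iff)
next
  case False
  then show ?thesis using st_EI_d_le by (simp add: dual_le_iff)
qed

lemma EI_d_eq_log_iff: "EI_d Q = of_real (log 2 (real CARD('n))) \<longleftrightarrow> permutation_DTPM Q"
proof
  assume max: "EI_d Q = of_real (log 2 (real CARD('n)))"
  then have "st (EI_d Q) = log 2 (real CARD('n))" by simp
  then obtain \<sigma> where \<sigma>: "\<sigma> permutes UNIV" "\<And>j k. a j k = (if j = \<sigma> k then 1 else 0)"
    by (rule permutation_if_st_max) blast
  have "(\<Sum>k\<in>UNIV. b (\<sigma> k) k) = 0"
    using im_EI_permutation[OF \<sigma>] max by simp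
  then have "(\<Sum>k\<in>UNIV. - b (\<sigma> k) k) = 0"
    by (simp add: sum_negf)
  then have "b (\<sigma> k) k = 0" for k
    using b_at_permutation(1)[OF \<sigma>(2)] by (subst (asm) sum_nonneg_eq_0_iff) auto
  then have "b j k = 0" for j k
    by (rule b_at_permutation(2)[OF \<sigma>(2)])
  with \<sigma> show "permutation_DTPM Q"
    by (auto simp: permutation_DTPM_def real_permutation_matrix_def)
next
  assume "permutation_DTPM Q"
  then obtain \<sigma> where \<sigma>: "\<sigma> permutes UNIV" "\<And>j k. a j k = (if j = \<sigma> k then 1 else 0)"
      and "\<And>j k. b j k = 0"
    by (auto simp: permutation_DTPM_def real_permutation_matrix_def vec_eq_iff)
  then show "EI_d Q = of_real (log 2 (real CARD('n)))"
    by (simp add: dual_eq_iff st_EI_permutation[OF \<sigma>] im_EI_permutation[OF \<sigma>])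
qed


section \<open>The minimum\<close>

lemma sum_gibbs_bound: "(\<Sum>j\<in>UNIV. \<Sum>k\<in>UNIV. (a j k - r j) / ln 2) = 0"
  by (simp add: sum_subtractf row_sums flip: sum_divide_distrib)

lemma st_EI_d_nonneg: "0 \<le> st (EI_d Q)"
proof -
  have "(\<Sum>j\<in>UNIV. \<Sum>k\<in>UNIV. (a j k - r j) / ln 2)
      \<le> (\<Sum>j\<in>UNIV. \<Sum>k\<in>UNIV. a j k * (log 2 (a j k) - log 2 (r j)))"
    by (intro sum_mono gibbs_term(1) a_nonneg r_nonneg a_zero_if_r_zero)
  then show ?thesis by (simp add: st_EI_d sum_gibbs_bound)
qed

lemma constant_rows_if_st_min:
  assumes "st (EI_d Q) = 0"
  shows "a j k = r j"
proof -
  have sums_eq: "(\<Sum>j\<in>UNIV. \<Sum>k\<in>UNIV. (a j k - r j) / ln 2) =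
      (\<Sum>j\<in>UNIV. \<Sum>k\<in>UNIV. a j k * (log 2 (a j k) - log 2 (r j)))"
    using assms by (simp add: st_EI_d sum_gibbs_bound)
  have "(a j k - r j) / ln 2 = a j k * (log 2 (a j k) - log 2 (r j))"
    by (rule double_sum_le_equality[OF _ sums_eq])
      (intro gibbs_term(1) a_nonneg r_nonneg a_zero_if_r_zero)
  then show ?thesis
    using gibbs_term(2)[OF a_nonneg r_nonneg a_zero_if_r_zero] by metis
qed

text \<open>
  In a row with positive mean the contribution is that of \<open>b j k - s j\<close>, which sums to zero by
  the choice of \<open>s j\<close>; in a zero row it vanishes together with the factors \<open>a j k\<close> and
  \<open>log 2 (a j k) - log 2 (r j)\<close>.
\<close>

lemma im_EI_constant_rows:
  assumes "\<And>j k. a j k = r j"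
  shows "im (EI_d Q) = 0"
proof -
  have summand: "a j k * (im (dual_log2 (Q $ j $ k)) - im (dual_log2 (Dual (r j) (s j)))) +
      b j k * (log 2 (a j k) - log 2 (r j)) = (if r j = 0 then 0 else (b j k - s j) / ln 2)"
    for j k
    using r_nonneg[of j]
    by (auto simp: assms im_dual_log2_pos less_le field_simps)
  have "(\<Sum>k\<in>UNIV. if r j = 0 then 0 else (b j k - s j) / ln 2) = 0" for j
    by (cases "r j = 0") (simp_all add: sum_subtractf row_sums flip: sum_divide_distrib)
  then show ?thesis by (simp only: im_EI_d summand) simp
qed

lemma EI_d_nonneg: "0 \<le> EI_d Q"
proof (cases "st (EI_d Q) = 0")
  case True
  then have "im (EI_d Q) = 0"
    by (intro im_EI_constant_rows constant_rows_if_st_min)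
  with True show ?thesis by (simp add: dual_le_iff)
next
  case False
  then show ?thesis using st_EI_d_nonneg by (simp add: dual_le_iff)
qed

lemma EI_d_eq_0_iff: "EI_d Q = 0 \<longleftrightarrow> (\<forall>j k. a j k = r j)"
proof
  assume "EI_d Q = 0"
  then show "\<forall>j k. a j k = r j" by (simp add: constant_rows_if_st_min)
next
  assume const: "\<forall>j k. a j k = r j"
  then have "im (EI_d Q) = 0" by (intro im_EI_constant_rows) blast
  with const show "EI_d Q = 0" by (simp add: dual_eq_iff st_EI_d)
qed

lemma constant_rows_iff:
  "(\<forall>j k. a j k = r j) \<longleftrightarrow> (\<exists>u. (\<Sum>j\<in>UNIV. u $ j) = 1 \<and> (\<forall>j k. a j k = u $ j))"
proof
  assume "\<forall>j k. a j k = r j"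
  then show "\<exists>u. (\<Sum>j\<in>UNIV. u $ j) = 1 \<and> (\<forall>j k. a j k = u $ j)"
    by (intro exI[of _ "\<chi> j. r j"]) (simp add: sum_mean)
next
  assume "\<exists>u. (\<Sum>j\<in>UNIV. u $ j) = 1 \<and> (\<forall>j k. a j k = u $ j)"
  then show "\<forall>j k. a j k = r j" by (auto simp: r_def)
qed

end


section \<open>Extremal values of the effective information\<close>

lemma DTPM_identity: "DTPM (dual_matrix (mat 1) 0 :: dual_number^'n^'n)"
  by (simp add: DTPM_dual_matrix_iff) (simp add: mat_def)

lemma permutation_DTPM_identity: "permutation_DTPM (dual_matrix (mat 1) 0 :: dual_number^'n^'n)"
  unfolding permutation_DTPM_def real_permutation_matrix_def
  by (auto intro!: exI[of _ id] permutes_id simp: dual_matrix_components mat_def vec_eq_iff)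

lemma DTPM_uniform:
  "DTPM (dual_matrix (\<chi> j k. 1 / real CARD('n)) 0 :: dual_number^'n^'n)"
  by (simp add: DTPM_dual_matrix_iff vec_eq_iff vector_matrix_mult_def)

theorem proposition6p3:
  fixes P :: "dual_number^'n^'n" and Ps Pi :: "real^'n^'n"
  assumes P_eq: "P = dual_matrix Ps Pi"
    and P: "DTPM P"
  shows
    "((\<exists>Q :: dual_number^'n^'n. DTPM Q \<and> EI_d Q = of_real (log 2 (real CARD('n)))) \<and>
      (\<forall>Q :: dual_number^'n^'n. DTPM Q \<longrightarrow> EI_d Q \<le> of_real (log 2 (real CARD('n)))) \<and>
      (EI_d P = of_real (log 2 (real CARD('n))) \<longleftrightarrow> permutation_DTPM P)) \<and>
     ((\<exists>Q :: dual_number^'n^'n. DTPM Q \<and> EI_d Q = 0) \<and>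
      (\<forall>Q :: dual_number^'n^'n. DTPM Q \<longrightarrow> 0 \<le> EI_d Q) \<and>
      (EI_d P = 0 \<longleftrightarrow>
        (\<exists>u :: real^'n. (\<Sum>j\<in>UNIV. u $ j) = 1 \<and>
           P = dual_matrix (outer_product u 1) Pi)))"
proof -
  let ?id = "dual_matrix (mat 1) 0 :: dual_number^'n^'n"
  let ?unif = "dual_matrix (\<chi> j k. 1 / real CARD('n)) 0 :: dual_number^'n^'n"
  note dtm = dual_transition_matrix.intro
  have zero_iff: "EI_d Q = 0 \<longleftrightarrow>
      (\<exists>u :: real^'n. (\<Sum>j\<in>UNIV. u $ j) = 1 \<and> (\<forall>j k. st (Q $ j $ k) = u $ j))"
    if "DTPM Q" for Q :: "dual_number^'n^'n"
    using dual_transition_matrix.EI_d_eq_0_iff[OF dtm[OF that]]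
      dual_transition_matrix.constant_rows_iff[OF dtm[OF that]] by simp
  have "EI_d ?id = of_real (log 2 (real CARD('n)))"
    using dual_transition_matrix.EI_d_eq_log_iff[OF dtm[OF DTPM_identity]]
      permutation_DTPM_identity by blast
  then have max_attained:
      "\<exists>Q :: dual_number^'n^'n. DTPM Q \<and> EI_d Q = of_real (log 2 (real CARD('n)))"
    using DTPM_identity by blast
  have "EI_d ?unif = 0"
    unfolding zero_iff[OF DTPM_uniform]
    by (intro exI[of _ "\<chi> j. 1 / real CARD('n)"]) (simp add: dual_matrix_components)
  then have min_attained: "\<exists>Q :: dual_number^'n^'n. DTPM Q \<and> EI_d Q = 0"
    using DTPM_uniform by blast
  have "P = dual_matrix (outer_product u 1) Pi \<longleftrightarrow> (\<forall>j k. st (P $ j $ k) = u $ j)" for u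
    by (auto simp: P_eq vec_eq_iff dual_eq_iff dual_matrix_components outer_product_def)
  then have min_iff: "EI_d P = 0 \<longleftrightarrow> (\<exists>u :: real^'n. (\<Sum>j\<in>UNIV. u $ j) = 1 \<and>
      P = dual_matrix (outer_product u 1) Pi)"
    by (simp add: zero_iff[OF P])
  show ?thesis
    using max_attained min_attained min_iff
      dual_transition_matrix.EI_d_le_log[OF dtm]
      dual_transition_matrix.EI_d_nonneg[OF dtm]
      dual_transition_matrix.EI_d_eq_log_iff[OF dtm[OF P]]
    by blast
qed

end
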